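(* For every real number $\alpha \ge 1$ there exists a chore allocation instance with $n=3$ agents, $m=6$ chores and superadditive cost functions that admits no $\alpha$-EFX allocation. In particular, an EFX allocation of chores need not exist for three agents with superadditive cost functions.
   Context: A chore allocation instance consists of a set $N=\{1,\dots,n\}$ of agents, a finite set $M$ of $m$ indivisible chores, and for each agent $i$ a cost function $c_i:2^M\to\mathbb{R}_{\ge 0}$ that is normalized ($c_i(\emptyset)=0$) and monotone ($c_i(S\cup\{e\})\ge c_i(S)$ for all $S\subseteq M$, $e\in M$). A cost function $c$ is superadditive if $c(S\cup T)\ge c(S)+c(T)$ for all $S,T\subseteq M$. An allocation is a partition $X=(X_1,\dots,X_n)$ of $M$ into $n$ (possibly empty) bundles, agent $i$ receiving $X_i$. For $\alpha\ge 1$, an allocation $X$ is $\alpha$-EFX if for all agents $i,j$ and every chore $e\in X_i$, $c_i(X_i\setminus\{e\})\le \alpha\cdot c_i(X_j)$; it is EFX if it is $1$-EFX.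
   Formalization: Superadditivity c(S∪T) ≥ c(S)+c(T) is required only for disjoint S,T ⊆ M (the standard meaning); demanded for all S,T, the case S=T would force c=0, and every allocation would then be EFX. *)

theory Defs
  imports Complex_Main
begin

definition cost_function :: "'a set \<Rightarrow> ('a set \<Rightarrow> real) \<Rightarrow> bool" where
  "cost_function M c \<longleftrightarrow>
     c {} = 0 \<and>
     (\<forall>S. S \<subseteq> M \<longrightarrow> c S \<ge> 0) \<and>
     (\<forall>S e. S \<subseteq> M \<longrightarrow> e \<in> M \<longrightarrow> c (S \<union> {e}) \<ge> c S)"

text \<open>Superadditivity for disjoint bundles (the standard meaning; for overlapping
  bundles the inequality would force c = 0).\<close>
definition superadditive :: "'a set \<Rightarrow> ('a set \<Rightarrow> real) \<Rightarrow> bool" where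
  "superadditive M c \<longleftrightarrow>
     (\<forall>S T. S \<subseteq> M \<longrightarrow> T \<subseteq> M \<longrightarrow> S \<inter> T = {} \<longrightarrow> c (S \<union> T) \<ge> c S + c T)"

definition allocation :: "nat \<Rightarrow> 'a set \<Rightarrow> (nat \<Rightarrow> 'a set) \<Rightarrow> bool" where
  "allocation n M X \<longleftrightarrow>
     (\<forall>i<n. X i \<subseteq> M) \<and>
     (\<forall>i<n. \<forall>j<n. i \<noteq> j \<longrightarrow> X i \<inter> X j = {}) \<and>
     (\<Union>i<n. X i) = M"

definition alpha_EFX :: "nat \<Rightarrow> (nat \<Rightarrow> 'a set \<Rightarrow> real) \<Rightarrow> (nat \<Rightarrow> 'a set) \<Rightarrow> real \<Rightarrow> bool" where
  "alpha_EFX n c X \<alpha> \<longleftrightarrow>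
     (\<forall>i<n. \<forall>j<n. \<forall>e\<in>X i. c i (X i - {e}) \<le> \<alpha> * c i (X j))"

end

theory Submission
  imports Defs
begin

text \<open>
  If \<open>\<ell>\<close> is a monotone integer level function, then \<open>c S = |S| * K ^ \<ell> S\<close> (and \<open>c S = 0\<close>
  at level 0) is superadditive, and for \<open>K\<close> large compared to \<open>\<alpha>\<close> an \<open>\<alpha>\<close>-EFX allocation is EFX for
  the levels. So it suffices to find monotone levels without an EFX allocation. For agent \<open>i\<close>,
  consider the graph on the chores \<open>0, \<dots>, 5\<close> that consists of the triangle on \<open>{0, 1, 2, 4} - {i}\<close>
  and the path \<open>3 - i - 5\<close>. A bundle has level 3 if it contains an edge; otherwise its level is 2 if
  it contains 4 or 5, else 1 if it contains 3, else 0.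

  A bundle of three or more chores that contains an edge for its owner keeps one after the removal
  of a suitable chore, so all three bundles would contain an edge, which takes seven chores. A
  bundle of three or more chores without an edge is \<open>{y, 3, 5}\<close> with \<open>y\<close> in the triangle, and too
  little of the triangle remains to give the other two bundles level 2. So all bundles are pairs.
  If two agents own 4 and 5, then the third bundle must be an edge in both their graphs, but within
  \<open>{0, 1, 2, 3}\<close> these have no common edge. If agent \<open>i\<close> owns both, then the other bundles are
  \<open>{i, 3}\<close> and \<open>{0, 1, 2} - {i}\<close>, and the owner of the former gives level 0 to the latter.
\<close>

text \<open>The path edges are listed only as seen from \<open>i\<close>; this suffices because
  \<open>has_edge\<close> tries both orders of a pair.\<close>

definition edge :: "nat \<Rightarrow> nat \<Rightarrow> nat \<Rightarrow> bool" where
  "edge i x y \<longleftrightarrow> x \<noteq> y \<and> {x, y} \<subseteq> {0, 1, 2, 4} - {i} \<or> x = i \<and> y \<in> {3, 5}"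

definition has_edge :: "nat \<Rightarrow> nat set \<Rightarrow> bool" where
  "has_edge i S \<longleftrightarrow> (\<exists>x\<in>S. \<exists>y\<in>S. edge i x y)"

definition level :: "nat \<Rightarrow> nat set \<Rightarrow> nat" where
  "level i S = (if has_edge i S then 3 else if 4 \<in> S \<or> 5 \<in> S then 2 else if 3 \<in> S then 1 else 0)"

section \<open>Superadditive costs from monotone levels\<close>

definition level_cost :: "real \<Rightarrow> ('a set \<Rightarrow> nat) \<Rightarrow> 'a set \<Rightarrow> real" where
  "level_cost K l S = real (card S) * (if l S = 0 then 0 else K ^ l S)"

lemma level_cost_nonneg: "1 \<le> K \<Longrightarrow> 0 \<le> level_cost K l S"
  by (simp add: level_cost_def)

lemma level_weight_mono:
  fixes K :: real
  assumes "1 \<le> K" "(m::nat) \<le> n"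
  shows "(if m = 0 then 0 else K ^ m) \<le> (if n = 0 then 0 else K ^ n)"
  using assms by (auto intro: power_increasing)

lemma cost_function_level_cost:
  assumes "finite M" "1 \<le> K" "mono l"
  shows "cost_function M (level_cost K l)"
  unfolding cost_function_def
proof (intro conjI allI impI)
  fix S e assume "S \<subseteq> M" "e \<in> M"
  have "finite S"
    using \<open>S \<subseteq> M\<close> \<open>finite M\<close> by (rule finite_subset)
  have "card S \<le> card (S \<union> {e})"
    using \<open>finite S\<close> by (intro card_mono) auto
  moreover have "l S \<le> l (S \<union> {e})"
    using \<open>mono l\<close> by (auto intro: monoD)
  ultimately show "level_cost K l S \<le> level_cost K l (S \<union> {e})"
    unfolding level_cost_def using \<open>1 \<le> K\<close>
    by (intro mult_mono level_weight_mono) auto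
qed (use assms in \<open>auto simp: level_cost_nonneg\<close>, simp add: level_cost_def)

text \<open>Cardinality is additive on disjoint bundles, and by monotonicity the weight of each part
  is at most the weight of the union.\<close>

lemma superadditive_level_cost:
  assumes "finite M" "1 \<le> K" "mono l"
  shows "superadditive M (level_cost K l)"
  unfolding superadditive_def
proof (intro allI impI)
  fix S T assume "S \<subseteq> M" "T \<subseteq> M" "S \<inter> T = {}"
  define w where "w n = (if n = 0 then 0 else K ^ n)" for n :: nat
  have "w (l S) \<le> w (l (S \<union> T))" "w (l T) \<le> w (l (S \<union> T))"
    unfolding w_def using assms by (simp_all only: level_weight_mono monoD sup_ge1 sup_ge2)
  then have "card S * w (l S) + card T * w (l T) \<le> card S * w (l (S \<union> T)) + card T * w (l (S \<union> T))"
    by (intro add_mono mult_left_mono) auto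
  also have "\<dots> = card (S \<union> T) * w (l (S \<union> T))"
    using \<open>S \<subseteq> M\<close> \<open>T \<subseteq> M\<close> \<open>S \<inter> T = {}\<close> \<open>finite M\<close>
    by (simp add: card_Un_disjoint finite_subset distrib_right)
  finally show "level_cost K l S + level_cost K l T \<le> level_cost K l (S \<union> T)"
    by (simp add: level_cost_def w_def)
qed

text \<open>A higher level multiplies the weight by at least \<open>K\<close>, while \<alpha> and
  the cardinality of \<open>T\<close> make up for a factor of at most \<alpha> * \<open>m\<close> <
  \<open>K\<close>. A level above that of \<open>T\<close> makes \<open>S\<close> nonempty, so its
  own cardinality factor is at least 1.\<close>

lemma level_le_if_level_cost_le:
  assumes "level_cost K l S \<le> \<alpha> * level_cost K l T"
    and "finite S" "l {} = 0" "card T \<le> m" "1 \<le> K" "0 \<le> \<alpha>" "\<alpha> * m < K"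
  shows "l S \<le> l T"
proof (rule ccontr)
  assume "\<not> l S \<le> l T"
  then have "l T < l S" by simp
  then have "S \<noteq> {}" using \<open>l {} = 0\<close> by auto
  then have "1 \<le> card S"
    using \<open>finite S\<close> by (simp add: Suc_leI card_gt_0_iff)
  have "0 < K" using \<open>1 \<le> K\<close> by simp
  have "0 < K ^ l S" using \<open>0 < K\<close> by simp
  have "K ^ l S \<le> card S * K ^ l S"
    using \<open>1 \<le> card S\<close> \<open>0 < K ^ l S\<close> by simp
  also have "\<dots> = level_cost K l S"
    using \<open>l T < l S\<close> by (simp add: level_cost_def)
  finally have *: "K ^ l S \<le> \<alpha> * level_cost K l T"
    using assms(1) by simp
  show False
  proof (cases "l T = 0")
    case True
    then show False using * \<open>0 < K ^ l S\<close> by (simp add: level_cost_def)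
  next
    case False
    have "K * K ^ l T \<le> K ^ l S"
      using \<open>1 \<le> K\<close> \<open>l T < l S\<close> power_increasing[of "Suc (l T)" "l S" K] by simp
    also note *
    also have "\<alpha> * level_cost K l T \<le> \<alpha> * (m * K ^ l T)"
      using False \<open>0 \<le> \<alpha>\<close> \<open>card T \<le> m\<close> \<open>0 < K\<close>
      by (auto simp: level_cost_def intro!: mult_left_mono mult_right_mono)
    also have "\<dots> < K * K ^ l T"
      using \<open>\<alpha> * m < K\<close> \<open>0 < K\<close> by (simp add: mult.assoc[symmetric])
    finally show False by simp
  qed
qed

section \<open>Edges and levels of small bundles\<close>

lemma mono_level: "mono (level i)"
proof (rule monoI)
  fix S T :: "nat set" assume "S \<subseteq> T"
  moreover from this have "has_edge i S \<Longrightarrow> has_edge i T"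
    unfolding has_edge_def by blast
  ultimately show "level i S \<le> level i T"
    unfolding level_def by auto
qed

lemma level_empty: "level i {} = 0"
  by (simp add: level_def has_edge_def)

lemma edge_neq: "i < 3 \<Longrightarrow> edge i x y \<Longrightarrow> x \<noteq> y"
  by (auto simp: edge_def)

lemma level_ge_3_iff: "3 \<le> level i S \<longleftrightarrow> has_edge i S"
  by (simp add: level_def)

lemma level_ge_2_iff: "2 \<le> level i S \<longleftrightarrow> has_edge i S \<or> 4 \<in> S \<or> 5 \<in> S"
  by (simp add: level_def)

lemma level_pos_iff: "0 < level i S \<longleftrightarrow> has_edge i S \<or> 3 \<in> S \<or> 4 \<in> S \<or> 5 \<in> S"
  by (auto simp: level_def)

lemma two_le_card_if_has_edge:
  assumes "has_edge i S" "finite S" "i < 3"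
  shows "2 \<le> card S"
proof -
  obtain x y where "x \<in> S" "y \<in> S" "x \<noteq> y"
    using assms edge_neq unfolding has_edge_def by blast
  then have "card {x, y} \<le> card S"
    using \<open>finite S\<close> by (intro card_mono) auto
  then show ?thesis using \<open>x \<noteq> y\<close> by simp
qed

lemma has_edge_remove:
  assumes "has_edge i S" "3 \<le> card S"
  obtains e where "e \<in> S" "has_edge i (S - {e})"
proof -
  obtain x y where xy: "x \<in> S" "y \<in> S" "edge i x y"
    using assms unfolding has_edge_def by blast
  have "card {x, y} < card S"
    using \<open>3 \<le> card S\<close> by (simp add: card_insert_if)
  then have "\<not> S \<subseteq> {x, y}"
    using card_mono[of "{x, y}" S] by auto
  then obtain e where "e \<in> S" "e \<noteq> x" "e \<noteq> y" by blast
  with xy that show thesis unfolding has_edge_def by blast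
qed

text \<open>Without an edge, at most one triangle vertex lies in \<open>S\<close>. If
  \<open>i\<close> is in \<open>S\<close>, then 3 and 5 are not, which leaves at most two chores;
  otherwise only 3 and 5 can join the triangle vertex.\<close>

lemma no_edge_card_ge_3:
  assumes "\<not> has_edge i S" "S \<subseteq> {0..<6}" "3 \<le> card S" "i < 3"
  obtains y where "y \<in> {0, 1, 2, 4} - {i}" "S = {y, 3, 5}"
proof -
  have dom: "x \<in> {0, 1, 2, 4} - {i} \<or> x = i \<or> x = 3 \<or> x = 5" if "x \<in> S" for x
    using that assms by force
  have "x = y" if "x \<in> S \<inter> ({0, 1, 2, 4} - {i})" "y \<in> S \<inter> ({0, 1, 2, 4} - {i})" for x y
  proof (rule ccontr)
    assume "x \<noteq> y"
    with that have "edge i x y" unfolding edge_def by simp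
    with that assms(1) show False unfolding has_edge_def by blast
  qed
  \<comment> \<open>If \<open>S\<close> misses the triangle, \<open>y\<close> is arbitrary here; the
    cardinality of \<open>S\<close> later forces it into the triangle.\<close>
  then obtain y where y: "S \<inter> ({0, 1, 2, 4} - {i}) \<subseteq> {y}"
    by (metis singletonI subsetI)
  have "i \<notin> S"
  proof
    assume "i \<in> S"
    then have "S \<subseteq> {y, i}"
      using y dom assms(1) unfolding has_edge_def edge_def by blast
    from card_mono[OF _ this] show False
      using \<open>3 \<le> card S\<close> by (auto simp: card_insert_if split: if_splits)
  qed
  then have sub: "S \<subseteq> {y, 3, 5}"
    using y dom by blast
  have "card {y, 3, 5} \<le> card S"
    using \<open>3 \<le> card S\<close> by (simp add: card_insert_if)
  with sub have eq: "S = {y, 3, 5}"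
    by (intro card_seteq) auto
  have "y \<noteq> 3" "y \<noteq> 5"
    using \<open>3 \<le> card S\<close> unfolding eq by (auto simp: card_insert_if)
  then have "y \<in> {0, 1, 2, 4} - {i}"
    using dom[of y] eq \<open>i \<notin> S\<close> by auto
  with eq that show thesis by blast
qed

text \<open>Without the chores 4 and 5, the graph of \<open>i\<close> keeps a single triangle edge
  and the path edge from \<open>i\<close> to 3.\<close>

lemma pair_with_edge:
  assumes "has_edge i S" "S \<subseteq> {0, 1, 2, 3}" "card S = 2" "i < 3"
  shows "S = {0, 1, 2} - {i} \<or> S = {i, 3}"
proof -
  obtain x y where "x \<in> S" "y \<in> S" "edge i x y"
    using assms(1) unfolding has_edge_def by blast
  moreover have "finite S"
    using \<open>card S = 2\<close> by (simp add: card_ge_0_finite)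
  moreover have "x \<noteq> y"
    using \<open>edge i x y\<close> \<open>i < 3\<close> edge_neq by blast
  ultimately have "S = {x, y}"
    using card_seteq[of S "{x, y}"] \<open>card S = 2\<close> by simp
  then consider "S \<subseteq> {0, 1, 2} - {i}" | "S = {i, 3}"
    using \<open>edge i x y\<close> \<open>S \<subseteq> {0, 1, 2, 3}\<close> unfolding edge_def by auto
  then show ?thesis
  proof cases
    case 1
    have "i \<in> {0, 1, 2}" using \<open>i < 3\<close> by auto
    then have "card ({0, 1, 2} - {i}) = 2" by simp
    with 1 have "S = {0, 1, 2} - {i}"
      using \<open>card S = 2\<close> by (intro card_subset_eq) auto
    then show ?thesis ..
  qed simp
qed

section \<open>No allocation is EFX for the levels\<close>

lemma no_level_EFX_allocation:
  assumes "allocation 3 {0..<6} X"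
  shows "\<exists>i<3. \<exists>j<3. \<exists>e\<in>X i. level i (X j) < level i (X i - {e})"
proof (rule ccontr)
  assume "\<not> ?thesis"
  then have efx: "level i (X i - {e}) \<le> level i (X j)" if "i < 3" "j < 3" "e \<in> X i" for i j e
    using that by (meson not_less)
  have sub: "X i \<subseteq> {0..<6}" and fin: "finite (X i)" if "i < 3" for i
    using assms that finite_subset[of "X i" "{0..<6}"] by (auto simp: allocation_def)
  have disj: "X i \<inter> X j = {}" if "i < 3" "j < 3" "i \<noteq> j" for i j
    using assms that by (auto simp: allocation_def)
  have owner: "\<exists>i<3. e \<in> X i" if "e < 6" for e
    using assms that unfolding allocation_def by (metis UN_E atLeastLessThan_iff le0 lessThan_iff)
  have third: "\<exists>k<3. k \<noteq> i \<and> k \<noteq> j" for i j :: nat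
    by presburger
  have card_sum: "card (X 0) + card (X 1) + card (X 2) = 6"
  proof -
    have "card (\<Union>i<3. X i) = (\<Sum>i<3. card (X i))"
      using fin disj by (intro card_UN_disjoint) auto
    then show ?thesis
      using assms by (simp add: allocation_def eval_nat_numeral)
  qed

  have card_le_2: "card (X i) \<le> 2" if "i < 3" for i
  proof (rule ccontr)
    assume "\<not> card (X i) \<le> 2"
    then have "3 \<le> card (X i)" by simp
    have "\<not> has_edge i (X i)"
    proof
      assume "has_edge i (X i)"
      then obtain e where "e \<in> X i" "has_edge i (X i - {e})"
        using has_edge_remove \<open>3 \<le> card (X i)\<close> by blast
      then have "2 \<le> card (X j)" if "j < 3" for j
        using efx[OF \<open>i < 3\<close> that] level_ge_3_iff two_le_card_if_has_edge[OF _ fin] that \<open>i < 3\<close>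
        by (metis order_trans)
      from this[of 0] this[of 1] this[of 2] have "\<not> 3 \<le> card (X i)"
        using card_sum \<open>i < 3\<close> by (auto simp: eval_nat_numeral less_Suc_eq)
      with \<open>3 \<le> card (X i)\<close> show False by simp
    qed
    then obtain y where y: "y \<in> {0, 1, 2, 4} - {i}" "X i = {y, 3, 5}"
      using no_edge_card_ge_3 sub \<open>3 \<le> card (X i)\<close> \<open>i < 3\<close> by metis
    have "2 \<le> level i (X i - {3})"
      by (simp add: y level_ge_2_iff)
    then have rich: "has_edge i (X j) \<or> 4 \<in> X j \<or> 5 \<in> X j" if "j < 3" for j
      using efx[OF \<open>i < 3\<close> that, of 3] y level_ge_2_iff[of i "X j"] by auto
    obtain j k where jk: "j < 3" "k < 3" "j \<noteq> i" "k \<noteq> i" "j \<noteq> k"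
      using third by metis
    define R where "R = {0, 1, 2, 4} - {i, y}"
    \<comment> \<open>Since \<open>X i\<close> holds 3 and 5, no path edge is left. So level 2 takes
      the chore 4 or an edge inside \<open>R\<close>, which has only two vertices. Two disjoint
      bundles cannot both achieve this.\<close>
    have rich': "4 \<in> R \<inter> X l \<or> R \<subseteq> X l" if "l < 3" "l \<noteq> i" for l
    proof -
      have notin: "y \<notin> X l" "3 \<notin> X l" "5 \<notin> X l"
        using disj[OF that(1) \<open>i < 3\<close> that(2)] y by auto
      have "i = 0 \<or> i = 1 \<or> i = 2" using \<open>i < 3\<close> by auto
      then show ?thesis
        using rich[OF \<open>l < 3\<close>] notin y unfolding has_edge_def edge_def R_def by auto
    qed
    have "R \<noteq> {}"
    proof -
      have "\<not> {0, 1, 2, 4} \<subseteq> {i, y}" by auto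
      then show ?thesis by (auto simp: R_def)
    qed
    moreover have "X j \<inter> X k = {}"
      using disj jk by blast
    ultimately show False
      using rich'[of j] rich'[of k] jk by blast
  qed
  have card2: "card (X i) = 2" if "i < 3" for i
    using that card_sum card_le_2[of 0] card_le_2[of 1] card_le_2[of 2]
    by (auto simp: eval_nat_numeral less_Suc_eq)
  \<comment> \<open>In a pair, removing the other chore leaves \<open>e\<close> alone, so EFX
    compares single chores with bundles.\<close>
  have level_elem: "level i {e} \<le> level i (X j)" if "i < 3" "j < 3" "e \<in> X i" for i j e
  proof -
    obtain x y where "X i = {x, y}" "x \<noteq> y"
      using card2[OF \<open>i < 3\<close>] by (auto simp: card_2_iff)
    then obtain e' where "e' \<in> X i" "X i - {e'} = {e}"
      using \<open>e \<in> X i\<close> by auto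
    then show ?thesis
      using efx[OF \<open>i < 3\<close> \<open>j < 3\<close>] by metis
  qed
  have level2: "has_edge i (X k)"
    if "i < 3" "k < 3" "4 \<in> X i \<or> 5 \<in> X i" "4 \<notin> X k" "5 \<notin> X k" for i k
  proof -
    have "2 \<le> level i {4}" "2 \<le> level i {5}"
      by (simp_all add: level_ge_2_iff)
    then have "2 \<le> level i (X k)"
      using level_elem that by (metis order_trans)
    then show ?thesis
      using that by (simp add: level_ge_2_iff)
  qed
  have pair: "X k = {0, 1, 2} - {i} \<or> X k = {i, 3}"
    if "i < 3" "k < 3" "4 \<in> X i \<or> 5 \<in> X i" "4 \<notin> X k" "5 \<notin> X k" for i k
  proof (rule pair_with_edge)
    show "X k \<subseteq> {0, 1, 2, 3}"
    proof
      fix x assume "x \<in> X k"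
      then have "x < 6" "x \<noteq> 4" "x \<noteq> 5"
        using sub[OF \<open>k < 3\<close>] that by auto
      then show "x \<in> {0, 1, 2, 3}" by auto
    qed
  qed (use that level2 card2 in auto)
  obtain i where i: "i < 3" "4 \<in> X i" using owner[of 4] by auto
  obtain j where j: "j < 3" "5 \<in> X j" using owner[of 5] by auto
  show False
  proof (cases "i = j")
    case False
    obtain k where k: "k < 3" "k \<noteq> i" "k \<noteq> j"
      using third by blast
    then have "4 \<notin> X k" "5 \<notin> X k"
      using disj i j by blast+
    then have Xk: "X k = {0, 1, 2} - {i} \<or> X k = {i, 3}" "X k = {0, 1, 2} - {j} \<or> X k = {j, 3}"
      using pair i j k by blast+
    have notin: "j \<in> {0, 1, 2}" "3 \<notin> {0, 1, 2::nat}"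
      using j by auto
    \<comment> \<open>For agent \<open>i\<close>, exactly one of \<open>j\<close> and 3 lies in
      \<open>X k\<close>; for agent \<open>j\<close>, both or neither do.\<close>
    have "j \<in> S \<longleftrightarrow> 3 \<notin> S" if "S = T - {i} \<or> S = {i, 3}" "j \<in> T" "3 \<notin> T" for S T
      using that False by blast
    from this[OF Xk(1) notin] have "j \<in> X k \<longleftrightarrow> 3 \<notin> X k" .
    moreover have "j \<in> S \<longleftrightarrow> 3 \<in> S" if "S = T - {j} \<or> S = {j, 3}" "3 \<notin> T" for S T
      using that by blast
    from this[OF Xk(2) notin(2)] have "j \<in> X k \<longleftrightarrow> 3 \<in> X k" .
    ultimately show False by blast
  next
    case True
    obtain k where k: "k < 3" "3 \<in> X k" using owner[of 3] by auto
    have "X i = {4, 5}"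
      using card2[OF \<open>i < 3\<close>] i j True by (auto simp: card_2_iff)
    then have "k \<noteq> i" using k by auto
    obtain l where l: "l < 3" "l \<noteq> i" "l \<noteq> k"
      using third by blast
    have "4 \<notin> X l" "5 \<notin> X l" "3 \<notin> X l"
      using disj[OF \<open>l < 3\<close>] i j k l True by blast+
    then have "X l \<noteq> {i, 3}" and "X l = {0, 1, 2} - {i} \<or> X l = {i, 3}"
      using pair i l by blast+
    then have Xl: "X l = {0, 1, 2} - {i}" by meson
    have "0 < level k {3}" by (simp add: level_pos_iff)
    also have "\<dots> \<le> level k (X l)"
      using level_elem k l by blast
    finally have "has_edge k (X l)"
      using \<open>4 \<notin> X l\<close> \<open>5 \<notin> X l\<close> \<open>3 \<notin> X l\<close> by (simp add: level_pos_iff)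
    \<comment> \<open>Here \<open>X l\<close> consists of \<open>k\<close> and \<open>l\<close>, but
      in its own graph \<open>k\<close> is joined only to 3 and 5.\<close>
    moreover have "i = 0 \<or> i = 1 \<or> i = 2" "k = 0 \<or> k = 1 \<or> k = 2"
      using i k by auto
    ultimately show False
      using \<open>k \<noteq> i\<close> unfolding Xl has_edge_def edge_def by auto
  qed
qed

section \<open>From levels back to costs\<close>

theorem theorem1:
  fixes \<alpha> :: real
  assumes "\<alpha> \<ge> 1"
  shows "\<exists>(M :: nat set) (c :: nat \<Rightarrow> nat set \<Rightarrow> real).
           finite M \<and> card M = 6 \<and>
           (\<forall>i<3. cost_function M (c i) \<and> superadditive M (c i)) \<and>
           \<not> (\<exists>X. allocation 3 M X \<and> alpha_EFX 3 c X \<alpha>)"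
proof -
  define M :: "nat set" where "M = {0..<6}"
  \<comment> \<open>A bundle has at most 6 chores, so \<open>K\<close> must exceed 6 *
    \<alpha>.\<close>
  define K where "K = 6 * \<alpha> + 1"
  define c where "c i = level_cost K (level i)" for i
  have "1 \<le> K" using assms by (simp add: K_def)
  have "finite M" by (simp add: M_def)
  have "\<not> alpha_EFX 3 c X \<alpha>" if X: "allocation 3 M X" for X
  proof
    assume EFX: "alpha_EFX 3 c X \<alpha>"
    obtain i j e where ije: "i < 3" "j < 3" "e \<in> X i" "level i (X j) < level i (X i - {e})"
      using no_level_EFX_allocation X unfolding M_def by blast
    have "X i \<subseteq> M" "X j \<subseteq> M"
      using X ije by (auto simp: allocation_def)
    have "finite (X i - {e})"
      using \<open>X i \<subseteq> M\<close> \<open>finite M\<close> by (auto intro: finite_subset)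
    moreover have "card (X j) \<le> 6"
      using card_mono[OF \<open>finite M\<close> \<open>X j \<subseteq> M\<close>] by (simp add: M_def)
    moreover have "level_cost K (level i) (X i - {e}) \<le> \<alpha> * level_cost K (level i) (X j)"
      using EFX ije by (auto simp: alpha_EFX_def c_def)
    ultimately have "level i (X i - {e}) \<le> level i (X j)"
      using assms level_empty \<open>1 \<le> K\<close> by (intro level_le_if_level_cost_le[of K _ _ \<alpha> _ 6]) (auto simp: K_def)
    with ije show False by simp
  qed
  moreover have "cost_function M (c i) \<and> superadditive M (c i)" for i
    unfolding c_def using \<open>finite M\<close> \<open>1 \<le> K\<close> mono_level
    by (simp add: cost_function_level_cost superadditive_level_cost)
  ultimately show ?thesis
    using \<open>finite M\<close> by (intro exI[of _ M] exI[of _ c]) (auto simp: M_def)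
qed

end
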